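(* Let $G$ be a connected graph of odd order $n\ge 3$. Then the following statements are equivalent: (i) $\rho(G)=\lfloor\frac n2\rfloor$; (ii) $\gamma_1^{\mathrm L}(G)=\rho(G)+1$; (iii) $G$ is a near-corona graph.
   Context: All graphs are finite, simple and undirected; $N(v)$ is the open and $N[v]=N(v)\cup\{v\}$ the closed neighborhood of $v$. A dominating set of $G$ is a set $D\subseteq V(G)$ such that every vertex not in $D$ has a neighbor in $D$. A $1$-limited dominating set is a dominating set $D$ with $|N(u)-D|\le 1$ for every $u\in D$; $\gamma_1^{\mathrm L}(G)$ is the minimum cardinality of a $1$-limited dominating set. A set $S\subseteq V(G)$ is a packing if $N[u]\cap N[v]=\emptyset$ for all distinct $u,v\in S$; $\rho(G)$ is the maximum cardinality of a packing. A pendant vertex is a vertex of degree $1$. A connected graph $G$ of odd order $n$ is a near-corona graph if it contains an independent set $P$ of size $\lfloor\frac n2\rfloor$ such that the closed neighborhoods $N[v]$, $v\in P$, are pairwise disjoint, and at most one vertex of $P$ has degree $2$ while all the remaining vertices of $P$ are pendant. *)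

theory Defs
  imports "Graph_Theory.Graph_Theory" "HOL-Library.Disjoint_Sets"
begin

text \<open>
  A finite simple undirected graph is a \<^locale>\<open>graph\<close>: a finite, loop-free, symmetric digraph
  without parallel arcs. An undirected edge is a pair of opposite arcs, so the undirected
  degree of a vertex is its \<^const>\<open>out_degree\<close>.
\<close>

definition neighborhood :: "('a, 'b) pre_digraph \<Rightarrow> 'a \<Rightarrow> 'a set" where
  "neighborhood G v = {u. v \<rightarrow>\<^bsub>G\<^esub> u}"

definition closed_neighborhood :: "('a, 'b) pre_digraph \<Rightarrow> 'a \<Rightarrow> 'a set" where
  "closed_neighborhood G v = insert v (neighborhood G v)"

definition pendant :: "('a, 'b) pre_digraph \<Rightarrow> 'a \<Rightarrow> bool" where
  "pendant G v \<longleftrightarrow> v \<in> verts G \<and> out_degree G v = 1"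

definition independent_set :: "('a, 'b) pre_digraph \<Rightarrow> 'a set \<Rightarrow> bool" where
  "independent_set G S \<longleftrightarrow> S \<subseteq> verts G \<and> (\<forall>u\<in>S. \<forall>v\<in>S. \<not> u \<rightarrow>\<^bsub>G\<^esub> v)"

definition dominating_set :: "('a, 'b) pre_digraph \<Rightarrow> 'a set \<Rightarrow> bool" where
  "dominating_set G D \<longleftrightarrow>
     D \<subseteq> verts G \<and> (\<forall>v \<in> verts G - D. \<exists>u\<in>D. u \<in> neighborhood G v)"

definition one_limited_dominating_set :: "('a, 'b) pre_digraph \<Rightarrow> 'a set \<Rightarrow> bool" where
  "one_limited_dominating_set G D \<longleftrightarrow>
     dominating_set G D \<and> (\<forall>u\<in>D. card (neighborhood G u - D) \<le> 1)"

definition packing :: "('a, 'b) pre_digraph \<Rightarrow> 'a set \<Rightarrow> bool" where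
  "packing G S \<longleftrightarrow> S \<subseteq> verts G \<and> disjoint_family_on (closed_neighborhood G) S"

text \<open>
  For a finite graph, the following minimum and maximum range over finite nonempty sets:
  \<^term>\<open>verts G\<close> is a 1-limited dominating set and \<^term>\<open>{}\<close> is a packing.
\<close>

definition one_limited_domination_number :: "('a, 'b) pre_digraph \<Rightarrow> nat" where
  "one_limited_domination_number G = Min (card ` {D. one_limited_dominating_set G D})"

definition packing_number :: "('a, 'b) pre_digraph \<Rightarrow> nat" where
  "packing_number G = Max (card ` {S. packing G S})"

definition near_corona_graph :: "('a, 'b) pre_digraph \<Rightarrow> bool" where
  "near_corona_graph G \<longleftrightarrow>
     graph G \<and> connected G \<and> odd (card (verts G)) \<and>
     (\<exists>P. independent_set G P \<and> card P = card (verts G) div 2 \<and>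
          disjoint_family_on (closed_neighborhood G) P \<and>
          card {v\<in>P. out_degree G v = 2} \<le> 1 \<and>
          (\<forall>v\<in>P. out_degree G v \<noteq> 2 \<longrightarrow> pendant G v))"

end

theory Submission
  imports Defs
begin

text \<open>
  Write \<open>n\<close> for the order, \<open>\<rho>\<close> for the packing number and \<open>\<gamma>\<close> for the 1-limited domination
  number. In a graph without isolated vertices three inequalities hold, each by one count.
  \<^item> \<open>2\<rho> \<le> n\<close>: the closed neighborhoods of a packing are disjoint and have at least two
    elements each.
  \<^item> \<open>n \<le> 2\<gamma>\<close>: in a 1-limited dominating set \<open>D\<close> every vertex is responsible for at most one
    vertex outside \<open>D\<close>, so the complement of \<open>D\<close> is no larger than \<open>D\<close>.
  \<^item> \<open>\<gamma> + \<rho> \<le> n\<close>: the complement of a packing is a 1-limited dominating set.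

  For \<open>n = 2k + 1\<close> they read \<open>\<rho> \<le> k\<close>, \<open>k + 1 \<le> \<gamma>\<close> and \<open>\<gamma> + \<rho> \<le> 2k + 1\<close>, which makes
  \<open>\<rho> = k\<close> equivalent to \<open>\<gamma> = \<rho> + 1\<close>. Finally, the closed neighborhoods of a packing of size
  \<open>k\<close> have at least \<open>2k\<close> elements in total out of \<open>2k + 1\<close>, so that at most one of the
  degrees in the packing exceeds 1, and then only by 1: this is the near-corona structure.
  Conversely the set that witnesses this structure is itself a packing of size \<open>k\<close>.
\<close>

section \<open>Neighborhoods and degrees\<close>

context graph
begin

lemma neighborhood_subset_verts: "neighborhood G v \<subseteq> verts G"
  by (auto simp: neighborhood_def)

lemma finite_neighborhood: "finite (neighborhood G v)"
  by (rule finite_subset[OF neighborhood_subset_verts]) simp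

lemma not_in_own_neighborhood: "v \<notin> neighborhood G v"
  by (auto simp: neighborhood_def dest: adj_not_same)

lemma neighborhood_sym: "u \<in> neighborhood G v \<longleftrightarrow> v \<in> neighborhood G u"
  using arcs_ends_symmetric[OF sym_arcs] by (auto simp: neighborhood_def)

text \<open>Without parallel arcs, counting arcs out of a vertex amounts to counting its neighbors.\<close>

lemma card_neighborhood: "card (neighborhood G v) = out_degree G v"
proof -
  have "neighborhood G v = head G ` out_arcs G v"
    by (auto simp: neighborhood_def arcs_ends_conv out_arcs_def)
  moreover have "inj_on (head G) (out_arcs G v)"
    by (auto intro!: inj_onI no_multi_arcs simp: arc_to_ends_def out_arcs_def)
  ultimately show ?thesis by (simp add: card_image out_degree_def)
qed

lemma card_closed_neighborhood: "card (closed_neighborhood G v) = Suc (out_degree G v)"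
  by (simp add: closed_neighborhood_def finite_neighborhood not_in_own_neighborhood
      card_neighborhood)

lemma closed_neighborhood_subset_verts:
  "v \<in> verts G \<Longrightarrow> closed_neighborhood G v \<subseteq> verts G"
  using neighborhood_subset_verts by (auto simp: closed_neighborhood_def)

text \<open>
  The first arc of a path from \<open>v\<close> to some other vertex supplies the neighbor. The inequalities
  below use connectedness only through this consequence.
\<close>

lemma connected_imp_no_isolated_vertex:
  assumes con: "connected G" and n: "card (verts G) \<ge> 2" and v: "v \<in> verts G"
  shows "neighborhood G v \<noteq> {}"
proof -
  have "\<not> verts G \<subseteq> {v}" using n card_mono[of "{v}" "verts G"] by auto
  then obtain w where w: "w \<in> verts G" "w \<noteq> v" by auto
  have "v \<rightarrow>\<^sup>*\<^bsub>mk_symmetric G\<^esub> w"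
    using con v w by (auto simp: connected_def strongly_connected_def)
  then have "v \<rightarrow>\<^sup>*\<^bsub>G\<^esub> w" using reachable_mk_symmetric_eq[OF sym_arcs] by simp
  then have "v \<rightarrow>\<^sup>+\<^bsub>G\<^esub> w" using w by blast
  then obtain x where "v \<rightarrow>\<^bsub>G\<^esub> x" by (meson tranclD)
  then show ?thesis by (auto simp: neighborhood_def)
qed

section \<open>Packings\<close>

lemma packing_finite: "packing G S \<Longrightarrow> finite S"
  by (auto simp: packing_def intro: finite_subset)

lemma finite_packings: "finite {S. packing G S}"
  by (rule finite_subset[of _ "Pow (verts G)"]) (auto simp: packing_def)

lemma packing_number_ge: "packing G S \<Longrightarrow> card S \<le> packing_number G"
  unfolding packing_number_def by (intro Max_ge) (auto simp: finite_packings)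

lemma maximum_packing_exists: obtains S where "packing G S" "card S = packing_number G"
proof -
  have "packing G {}" by (simp add: packing_def disjoint_family_on_def)
  then have "packing_number G \<in> card ` {S. packing G S}"
    unfolding packing_number_def by (intro Max_in) (auto simp: finite_packings)
  then show ?thesis using that by auto
qed

lemma packing_common_closed_neighbor:
  assumes "packing G S" "u \<in> S" "v \<in> S" "w \<in> closed_neighborhood G u" "w \<in> closed_neighborhood G v"
  shows "u = v"
  using assms by (auto simp: packing_def disjoint_family_on_def)

lemma packing_independent:
  assumes S: "packing G S"
  shows "independent_set G S"
  unfolding independent_set_def
proof (intro conjI ballI notI)
  show "S \<subseteq> verts G" using S by (simp add: packing_def)
  fix u v assume uv: "u \<in> S" "v \<in> S" "u \<rightarrow>\<^bsub>G\<^esub> v"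
  then have "u = v"
    using packing_common_closed_neighbor[OF S, of u v v]
    by (auto simp: closed_neighborhood_def neighborhood_def)
  with uv show False using adj_not_same by blast
qed

text \<open>The closed neighborhoods of a packing are disjoint and fit together into the vertex set.\<close>

lemma packing_degree_sum_le:
  assumes S: "packing G S"
  shows "(\<Sum>v\<in>S. Suc (out_degree G v)) \<le> card (verts G)"
proof -
  have "finite (closed_neighborhood G v)" for v
    by (simp add: closed_neighborhood_def finite_neighborhood)
  moreover have "\<forall>u\<in>S. \<forall>v\<in>S. u \<noteq> v \<longrightarrow> closed_neighborhood G u \<inter> closed_neighborhood G v = {}"
    using S by (simp add: packing_def disjoint_family_on_def)
  ultimately have "(\<Sum>v\<in>S. Suc (out_degree G v)) = card (\<Union>v\<in>S. closed_neighborhood G v)"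
    using packing_finite[OF S] by (simp add: card_UN_disjoint card_closed_neighborhood)
  also have "\<dots> \<le> card (verts G)"
    using S closed_neighborhood_subset_verts by (intro card_mono) (auto simp: packing_def)
  finally show ?thesis .
qed

lemma out_degree_pos:
  "neighborhood G v \<noteq> {} \<Longrightarrow> out_degree G v \<ge> 1"
  using finite_neighborhood[of v] by (auto simp flip: card_neighborhood simp: Suc_le_eq card_gt_0_iff)

text \<open>
  The excess of a vertex is its degree minus 1. This bound on the total excess of a packing
  gives both the bound on the packing number and the near-corona structure.
\<close>

lemma packing_excess_le:
  assumes S: "packing G S" and no_iso: "\<And>v. v \<in> verts G \<Longrightarrow> neighborhood G v \<noteq> {}"
  shows "2 * card S + (\<Sum>v\<in>S. out_degree G v - 1) \<le> card (verts G)"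
proof -
  have "Suc (out_degree G v) = 2 + (out_degree G v - 1)" if "v \<in> S" for v
    using that S out_degree_pos[OF no_iso, of v] by (auto simp: packing_def)
  then have "(\<Sum>v\<in>S. Suc (out_degree G v)) = 2 * card S + (\<Sum>v\<in>S. out_degree G v - 1)"
    by (simp only: sum.distrib sum_constant cong: sum.cong) simp
  with packing_degree_sum_le[OF S] show ?thesis by simp
qed

lemma packing_number_le_half:
  assumes "\<And>v. v \<in> verts G \<Longrightarrow> neighborhood G v \<noteq> {}"
  shows "2 * packing_number G \<le> card (verts G)"
  using packing_excess_le[OF _ assms] maximum_packing_exists by (metis add_leD1)

section \<open>1-limited dominating sets\<close>

lemma finite_one_limited_dominating_sets: "finite {D. one_limited_dominating_set G D}"
  by (rule finite_subset[of _ "Pow (verts G)"])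
    (auto simp: one_limited_dominating_set_def dominating_set_def)

lemma one_limited_domination_number_le:
  "one_limited_dominating_set G D \<Longrightarrow> one_limited_domination_number G \<le> card D"
  unfolding one_limited_domination_number_def
  by (intro Min_le) (auto simp: finite_one_limited_dominating_sets)

lemma minimum_one_limited_dominating_set_exists:
  obtains D where "one_limited_dominating_set G D" "card D = one_limited_domination_number G"
proof -
  have empty: "neighborhood G u - verts G = {}" for u using neighborhood_subset_verts by auto
  have "one_limited_dominating_set G (verts G)"
    by (simp add: one_limited_dominating_set_def dominating_set_def empty)
  then have "one_limited_domination_number G \<in> card ` {D. one_limited_dominating_set G D}"
    unfolding one_limited_domination_number_def
    by (intro Min_in) (auto simp: finite_one_limited_dominating_sets)
  then show ?thesis using that by auto
qed

text \<open>
  The complement of \<open>D\<close> is covered by the sets \<^term>\<open>neighborhood G u - D\<close> with \<open>u\<close> in \<open>D\<close>, none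
  of which has more than one element.
\<close>

lemma one_limited_dominating_set_ge_half:
  assumes D: "one_limited_dominating_set G D"
  shows "card (verts G) \<le> 2 * card D"
proof -
  have sub: "D \<subseteq> verts G" and lim: "\<And>u. u \<in> D \<Longrightarrow> card (neighborhood G u - D) \<le> 1"
    using D by (auto simp: one_limited_dominating_set_def dominating_set_def)
  have fin: "finite D" using sub by (rule finite_subset) simp
  have "verts G - D \<subseteq> (\<Union>u\<in>D. neighborhood G u - D)"
    using D neighborhood_sym by (fastforce simp: one_limited_dominating_set_def dominating_set_def)
  then have "card (verts G - D) \<le> card (\<Union>u\<in>D. neighborhood G u - D)"
    using fin finite_neighborhood by (intro card_mono) auto
  also have "\<dots> \<le> (\<Sum>u\<in>D. card (neighborhood G u - D))" by (rule card_UN_le[OF fin])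
  also have "\<dots> \<le> card D" using sum_mono[OF lim, of D] by simp
  finally show ?thesis using sub fin by (simp add: card_Diff_subset)
qed

lemma one_limited_domination_number_ge_half:
  "card (verts G) \<le> 2 * one_limited_domination_number G"
  using one_limited_dominating_set_ge_half minimum_one_limited_dominating_set_exists by metis

text \<open>
  A vertex of a packing has its neighbors outside the packing, so the complement dominates it;
  a vertex with two neighbors in a packing would lie in two of the disjoint closed
  neighborhoods, so the complement is 1-limited.
\<close>

lemma packing_complement_one_limited_dominating:
  assumes S: "packing G S" and no_iso: "\<And>v. v \<in> verts G \<Longrightarrow> neighborhood G v \<noteq> {}"
  shows "one_limited_dominating_set G (verts G - S)"
  unfolding one_limited_dominating_set_def dominating_set_def
proof (intro conjI ballI)
  fix v assume v: "v \<in> verts G - (verts G - S)"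
  then obtain u where u: "u \<in> neighborhood G v" using no_iso by blast
  moreover have "u \<notin> S"
    using u v packing_independent[OF S] by (auto simp: independent_set_def neighborhood_def)
  ultimately show "\<exists>u\<in>verts G - S. u \<in> neighborhood G v"
    using neighborhood_subset_verts by blast
next
  fix u assume "u \<in> verts G - S"
  have "x = y" if "x \<in> neighborhood G u - (verts G - S)" "y \<in> neighborhood G u - (verts G - S)"
    for x y
    using that neighborhood_subset_verts[of u] neighborhood_sym[of _ u]
      packing_common_closed_neighbor[OF S, of x y u]
    by (auto simp: closed_neighborhood_def)
  then show "card (neighborhood G u - (verts G - S)) \<le> 1"
    using finite_neighborhood[of u] by (simp add: card_le_Suc0_iff_eq)
qed simp

lemma one_limited_domination_number_plus_packing_number_le:
  assumes "\<And>v. v \<in> verts G \<Longrightarrow> neighborhood G v \<noteq> {}"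
  shows "one_limited_domination_number G + packing_number G \<le> card (verts G)"
proof -
  obtain S where S: "packing G S" "card S = packing_number G" by (rule maximum_packing_exists)
  then have sub: "S \<subseteq> verts G" by (simp add: packing_def)
  have "one_limited_domination_number G \<le> card (verts G - S)"
    using packing_complement_one_limited_dominating[OF S(1) assms]
    by (rule one_limited_domination_number_le)
  also have "\<dots> = card (verts G) - packing_number G"
    using S sub packing_finite by (simp add: card_Diff_subset)
  finally show ?thesis
    using card_mono[OF finite_verts sub] S(2) by simp
qed

section \<open>Near-corona graphs\<close>

text \<open>A sum of excesses that is at most 1 allows a single excess of 1 and no larger one.\<close>

lemma half_packing_degrees:
  assumes P: "packing G P" and no_iso: "\<And>v. v \<in> verts G \<Longrightarrow> neighborhood G v \<noteq> {}"
    and half: "card (verts G) \<le> 2 * card P + 1"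
  shows "card {v\<in>P. out_degree G v = 2} \<le> 1"
    and "\<forall>v\<in>P. out_degree G v \<noteq> 2 \<longrightarrow> pendant G v"
proof -
  have fin: "finite P" by (rule packing_finite[OF P])
  have excess: "(\<Sum>v\<in>P. out_degree G v - 1) \<le> 1"
    using packing_excess_le[OF P no_iso] half by simp
  have "card {v\<in>P. out_degree G v = 2} = (\<Sum>v\<in>{v\<in>P. out_degree G v = 2}. out_degree G v - 1)"
    by simp
  also have "\<dots> \<le> (\<Sum>v\<in>P. out_degree G v - 1)"
    using fin by (intro sum_mono2) auto
  finally show "card {v\<in>P. out_degree G v = 2} \<le> 1" using excess by simp
  show "\<forall>v\<in>P. out_degree G v \<noteq> 2 \<longrightarrow> pendant G v"
  proof (intro ballI impI)
    fix v assume v: "v \<in> P" "out_degree G v \<noteq> 2"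
    have "out_degree G v - 1 \<le> 1"
      using member_le_sum[of v P "\<lambda>v. out_degree G v - 1"] v fin excess by simp
    moreover have "v \<in> verts G" using v P by (auto simp: packing_def)
    ultimately show "pendant G v"
      using v out_degree_pos[OF no_iso, of v] by (simp add: pendant_def)
  qed
qed

lemma near_corona_graph_iff_packing_number:
  assumes con: "connected G" and odd: "odd (card (verts G))"
    and no_iso: "\<And>v. v \<in> verts G \<Longrightarrow> neighborhood G v \<noteq> {}"
  shows "near_corona_graph G \<longleftrightarrow> packing_number G = card (verts G) div 2"
proof
  assume "near_corona_graph G"
  then obtain P where "packing G P" "card P = card (verts G) div 2"
    by (auto simp: near_corona_graph_def independent_set_def packing_def)
  then show "packing_number G = card (verts G) div 2"
    using packing_number_ge[of P] packing_number_le_half[OF no_iso] by simp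
next
  assume half: "packing_number G = card (verts G) div 2"
  obtain P where P: "packing G P" "card P = packing_number G" by (rule maximum_packing_exists)
  have "card (verts G) \<le> 2 * card P + 1" using P half by simp
  note degrees = half_packing_degrees[OF P(1) no_iso this]
  show "near_corona_graph G"
    unfolding near_corona_graph_def
  proof (intro conjI exI[of _ P])
    show "graph G" by unfold_locales
    show "disjoint_family_on (closed_neighborhood G) P" using P by (simp add: packing_def)
  qed (use con odd P half degrees packing_independent in auto)
qed

end

section \<open>The equivalence\<close>

theorem corollary16:
  fixes G :: "('a, 'b) pre_digraph"
  assumes "graph G"
    and "connected G"
    and "odd (card (verts G))"
    and "card (verts G) \<ge> 3"
  shows "(packing_number G = card (verts G) div 2
            \<longleftrightarrow> one_limited_domination_number G = packing_number G + 1)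
       \<and> (one_limited_domination_number G = packing_number G + 1
            \<longleftrightarrow> near_corona_graph G)"
proof -
  interpret graph G by fact
  have no_iso: "neighborhood G v \<noteq> {}" if "v \<in> verts G" for v
    using connected_imp_no_isolated_vertex assms that by simp
  obtain k where "card (verts G) = 2 * k + 1" using assms(3) by (rule oddE)
  then have "packing_number G = card (verts G) div 2
      \<longleftrightarrow> one_limited_domination_number G = packing_number G + 1"
    using packing_number_le_half[OF no_iso] one_limited_domination_number_ge_half
      one_limited_domination_number_plus_packing_number_le[OF no_iso]
    by auto
  then show ?thesis
    using near_corona_graph_iff_packing_number[OF assms(2,3) no_iso] by simp
qed

end
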